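(* Let $f:\mathbb{R}^n\to\mathbb{R}$ be twice continuously differentiable, let $\eta>0$, let $\boldsymbol\theta^t\in\mathbb{R}^n$ satisfy $\nabla f(\boldsymbol\theta^t)\neq 0$, and let $\boldsymbol\theta^{t+1}=\boldsymbol\theta^t-\eta\nabla f(\boldsymbol\theta^t)$. Let $$L_t:=\sup_{\boldsymbol\theta\in\overline{\boldsymbol\theta^t\boldsymbol\theta^{t+1}}}\lambda_{\max}(\nabla^2 f(\boldsymbol\theta))$$ be the maximum sharpness along the line segment $\overline{\boldsymbol\theta^t\boldsymbol\theta^{t+1}}$ between $\boldsymbol\theta^t$ and $\boldsymbol\theta^{t+1}$. Then $$\frac{2}{\eta}\cdot\bigl(\mathsf{RP}(\boldsymbol\theta^t)+1\bigr)\le L_t .$$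
   Context: The relative progress ratio (for step size $\eta$) is $$\mathsf{RP}(\boldsymbol\theta):=\frac{f(\boldsymbol\theta-\eta\nabla f(\boldsymbol\theta))-f(\boldsymbol\theta)}{\eta\|\nabla f(\boldsymbol\theta)\|^2},$$ where $\|\cdot\|$ is the Euclidean norm. The sharpness at $\boldsymbol\theta$ is $\lambda_{\max}(\nabla^2 f(\boldsymbol\theta))$, the largest eigenvalue of the Hessian of $f$ at $\boldsymbol\theta$. *)

theory Defs
  imports "HOL-Analysis.Analysis"
begin

definition gradient :: "('a::real_inner \<Rightarrow> real) \<Rightarrow> 'a \<Rightarrow> 'a" where
  "gradient f x = (THE D. GDERIV f x :> D)"

lemma gradient_eqI:
  assumes "GDERIV f x :> D"
  shows "gradient f x = D"
  unfolding gradient_def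
proof (rule the_equality)
  fix D' assume "GDERIV f x :> D'"
  then have "(\<lambda>h. h \<bullet> D') = (\<lambda>h. h \<bullet> D)"
    using assms unfolding gderiv_def by (rule has_derivative_unique)
  then show "D' = D"
    by (metis vector_eq_ldot)
qed (rule assms)

(* The (i, j) entry is the j-th partial derivative of the i-th partial derivative of f. *)
definition hessian :: "(real^'n \<Rightarrow> real) \<Rightarrow> real^'n \<Rightarrow> real^'n^'n" where
  "hessian f x = jacobian (gradient f) (at x)"

definition twice_continuously_differentiable :: "(real^'n \<Rightarrow> real) \<Rightarrow> bool" where
  "twice_continuously_differentiable f \<longleftrightarrow>
     (\<forall>x. f differentiable (at x)) \<and>
     (\<forall>x. gradient f differentiable (at x)) \<and>
     continuous_on UNIV (hessian f)"

definition eigenvalue :: "real^'n^'n \<Rightarrow> real \<Rightarrow> bool" where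
  "eigenvalue A l \<longleftrightarrow> (\<exists>v. v \<noteq> 0 \<and> A *v v = l *\<^sub>R v)"

(* Only meaningful if A has a real eigenvalue, e.g. if A is symmetric. *)
definition lambda_max :: "real^'n^'n \<Rightarrow> real" where
  "lambda_max A = (GREATEST l. eigenvalue A l)"

definition sharpness :: "(real^'n \<Rightarrow> real) \<Rightarrow> real^'n \<Rightarrow> real" where
  "sharpness f x = lambda_max (hessian f x)"

definition relative_progress :: "real \<Rightarrow> (real^'n \<Rightarrow> real) \<Rightarrow> real^'n \<Rightarrow> real" where
  "relative_progress \<eta> f x =
     (f (x - \<eta> *\<^sub>R gradient f x) - f x) / (\<eta> * (norm (gradient f x))\<^sup>2)"

end

(* Taylor expansion of f along the gradient step gives
   f \<theta>' - f \<theta> = - \<eta> |g|^2 + \<eta>^2/2 g.H(\<xi>)g with \<xi> on the segment and g the gradient at \<theta>.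
   The Hessian is symmetric (Schwarz), so lambda_max is attained as the maximum of the Rayleigh
   quotient and bounds g.H(\<xi>)g / |g|^2.  The supremum is finite because the Rayleigh quotient
   is bounded on the compact set of segment points times unit vectors. *)

theory Submission
  imports Defs
begin

section \<open>Symmetric matrices and the Rayleigh quotient\<close>

text \<open>Symmetry is needed as a property of the bilinear form: to merge cross terms of a
  quadratic form, and to obtain a symmetric Hessian from limits. Testing on basis vectors recovers
  the entries.\<close>

lemma symmetric_matrix_iff_inner:
  fixes A :: "real^'n^'n"
  shows "transpose A = A \<longleftrightarrow> (\<forall>u v. u \<bullet> (A *v v) = v \<bullet> (A *v u))"
proof
  assume A: "transpose A = A"
  show "\<forall>u v. u \<bullet> (A *v v) = v \<bullet> (A *v u)"
    by (metis A dot_lmul_matrix inner_commute transpose_matrix_vector)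
next
  assume *: "\<forall>u v. u \<bullet> (A *v v) = v \<bullet> (A *v u)"
  have "A $ j $ i = A $ i $ j" for i j
    using *[rule_format, of "axis i 1" "axis j 1"]
    by (simp add: inner_axis' matrix_vector_mul_component)
       (simp add: inner_axis)
  then show "transpose A = A"
    by (simp add: transpose_def vec_eq_iff)
qed

lemma continuous_on_matrix_vector_mult [continuous_intros]:
  fixes A :: "'a::topological_space \<Rightarrow> real^'n^'m"
  assumes "continuous_on S A" and "continuous_on S v"
  shows "continuous_on S (\<lambda>x. A x *v v x)"
  unfolding matrix_vector_mult_def
  by (intro continuous_intros assms)

text \<open>Near t = 0 the linear term dominates and changes sign with t, unless its coefficient
  vanishes.\<close>

lemma linear_coeff_zero_if_quadratic_nonneg:
  fixes a b :: real
  assumes nonneg: "\<And>t. 0 \<le> 2 * t * a + t\<^sup>2 * b"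
  shows "a = 0"
proof (rule ccontr)
  assume a: "a \<noteq> 0"
  \<comment> \<open>This choice gives c > 0 and b < 2c whatever the sign of b, so that t = -a/c
    makes the quadratic negative.\<close>
  define c where "c = \<bar>b\<bar> + 1"
  have c: "c > 0" "b < 2 * c" by (auto simp: c_def)
  have "2 * (- a / c) * a + (- a / c)\<^sup>2 * b = (a / c)\<^sup>2 * (b - 2 * c)"
    using c by (simp add: field_simps power2_eq_square)
  also have "\<dots> < 0"
    using a c by (intro mult_pos_neg) auto
  finally show False
    using nonneg[of "- a / c"] by linarith
qed

text \<open>First-order optimality: the form
  \<open>\<mu> * (x \<bullet> x) - x \<bullet> (A *v x)\<close> is nonnegative and vanishes at
  \<open>v\<close>, so its directional derivatives there are zero. In the direction of the residual
  \<open>w\<close> the derivative is twice \<open>w \<bullet> w\<close>.\<close>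

lemma eigenvector_if_max_Rayleigh:
  fixes A :: "real^'n^'n"
  assumes sym: "transpose A = A"
    and le: "\<And>x. x \<bullet> (A *v x) \<le> \<mu> * (x \<bullet> x)"
    and eq: "v \<bullet> (A *v v) = \<mu> * (v \<bullet> v)"
  shows "A *v v = \<mu> *\<^sub>R v"
proof -
  define w where "w = \<mu> *\<^sub>R v - A *v v"
  have comm: "w \<bullet> (A *v v) = v \<bullet> (A *v w)"
    using sym unfolding symmetric_matrix_iff_inner by blast
  have "0 \<le> 2 * t * (w \<bullet> w) + t\<^sup>2 * (\<mu> * (w \<bullet> w) - w \<bullet> (A *v w))" for t
  proof -
    have "0 \<le> \<mu> * ((v + t *\<^sub>R w) \<bullet> (v + t *\<^sub>R w)) - (v + t *\<^sub>R w) \<bullet> (A *v (v + t *\<^sub>R w))"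
      using le[of "v + t *\<^sub>R w"] by simp
    \<comment> \<open>The constant term drops out by \<open>eq\<close>; symmetry, through
      \<open>comm\<close>, merges the two cross terms.\<close>
    also have "\<dots> = 2 * t * (\<mu> * (w \<bullet> v) - w \<bullet> (A *v v))
        + t\<^sup>2 * (\<mu> * (w \<bullet> w) - w \<bullet> (A *v w))"
      using eq comm
      by (simp add: matrix_vector_right_distrib matrix_vector_mult_scaleR inner_add_left
          inner_add_right inner_commute[of v w] power2_eq_square algebra_simps)
    also have "\<mu> * (w \<bullet> v) - w \<bullet> (A *v v) = w \<bullet> w"
      using w_def inner_diff_right inner_scaleR_right by metis
    finally show ?thesis .
  qed
  then have "w \<bullet> w = 0"
    by (rule linear_coeff_zero_if_quadratic_nonneg)
  then show ?thesis by (simp add: w_def)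
qed

text \<open>\<open>GREATEST\<close> has a useful value only once a greatest eigenvalue is exhibited.
  A maximizer of the Rayleigh quotient on the compact unit sphere is an eigenvector, and every
  eigenvalue is itself a value of that quotient.\<close>

lemma lambda_max_Rayleigh:
  fixes A :: "real^'n^'n"
  assumes sym: "transpose A = A"
  obtains v where "norm v = 1" and "v \<bullet> (A *v v) = lambda_max A"
    and "\<And>x. x \<bullet> (A *v x) \<le> lambda_max A * (norm x)\<^sup>2"
proof -
  have "continuous_on (sphere 0 1) (\<lambda>v. v \<bullet> (A *v v))"
    by (intro continuous_intros)
  \<comment> \<open>An arbitrary basis vector shows that the sphere is nonempty, as attaining the
    supremum requires.\<close>
  moreover have "axis undefined 1 \<in> sphere (0 :: real^'n) 1"
    by simp
  ultimately obtain v where v: "norm v = 1"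
    and max: "\<And>x. norm x = 1 \<Longrightarrow> x \<bullet> (A *v x) \<le> v \<bullet> (A *v v)"
    using continuous_attains_sup[OF compact_sphere, of 0 1 "\<lambda>v. v \<bullet> (A *v v)"]
    by (metis (no_types, lifting) dist_0_norm empty_iff mem_sphere)
  define \<mu> where "\<mu> = v \<bullet> (A *v v)"
  have le: "x \<bullet> (A *v x) \<le> \<mu> * (norm x)\<^sup>2" for x
  proof (cases "x = 0")
    case False
    then have "(inverse (norm x) *\<^sub>R x) \<bullet> (A *v (inverse (norm x) *\<^sub>R x)) \<le> \<mu>"
      unfolding \<mu>_def by (intro max) simp
    then show ?thesis
      using False by (simp add: matrix_vector_mult_scaleR field_simps power2_eq_square)
  qed simp
  have "A *v v = \<mu> *\<^sub>R v"
  proof (rule eigenvector_if_max_Rayleigh[OF sym])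
    show "v \<bullet> (A *v v) = \<mu> * (v \<bullet> v)"
      using v by (simp add: \<mu>_def dot_square_norm)
  qed (use le in \<open>simp add: dot_square_norm\<close>)
  then have "eigenvalue A \<mu>"
    using v unfolding eigenvalue_def by (metis norm_zero zero_neq_one)
  moreover have "l \<le> \<mu>" if "eigenvalue A l" for l
  proof -
    obtain x where "x \<noteq> 0" "A *v x = l *\<^sub>R x"
      using \<open>eigenvalue A l\<close> unfolding eigenvalue_def by blast
    then show ?thesis
      using le[of x] by (simp add: dot_square_norm)
  qed
  ultimately have "lambda_max A = \<mu>"
    unfolding lambda_max_def by (rule Greatest_equality)
  then show thesis
    using that v le \<mu>_def by simp
qed

section \<open>Symmetry of the Hessian\<close>

lemma twice_continuously_differentiableD:
  assumes "twice_continuously_differentiable f"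
  shows has_derivative_gradient: "(f has_derivative (\<lambda>h. h \<bullet> gradient f x)) (at x)"
    and has_derivative_hessian: "(gradient f has_derivative (\<lambda>h. hessian f x *v h)) (at x)"
    and continuous_on_hessian: "continuous_on UNIV (hessian f)"
proof -
  obtain D where D: "(f has_derivative D) (at x)"
    using assms unfolding twice_continuously_differentiable_def differentiable_def by blast
  \<comment> \<open>Riesz representation: \<open>adjoint D 1\<close> represents the functional
    \<open>D\<close> and so is the vector described by \<open>THE\<close> in
    \<open>gradient\<close>.\<close>
  then have "D = (\<lambda>h. h \<bullet> adjoint D 1)"
    using adjoint_works[OF has_derivative_linear[OF D], of _ 1] by (simp add: fun_eq_iff)
  then have "GDERIV f x :> adjoint D 1"
    using D by (simp add: gderiv_def)
  then show "(f has_derivative (\<lambda>h. h \<bullet> gradient f x)) (at x)"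
    using gradient_eqI gderiv_def by metis
  show "(gradient f has_derivative (\<lambda>h. hessian f x *v h)) (at x)"
    using assms unfolding twice_continuously_differentiable_def hessian_def
    by (simp add: jacobian_works)
  show "continuous_on UNIV (hessian f)"
    using assms unfolding twice_continuously_differentiable_def by blast
qed

lemma DERIV_along_line:
  assumes "twice_continuously_differentiable f"
  shows "((\<lambda>t. f (x + t *\<^sub>R d)) has_real_derivative d \<bullet> gradient f (x + t *\<^sub>R d)) (at t)"
proof -
  have "((\<lambda>t. x + t *\<^sub>R d) has_derivative (\<lambda>h. h *\<^sub>R d)) (at t)"
    by (auto intro!: derivative_eq_intros)
  from has_derivative_compose[OF this has_derivative_gradient[OF assms]] show ?thesis
    by (simp add: has_field_derivative_def mult_commute_abs)
qed

text \<open>The vector \<open>w\<close> is kept apart from the direction \<open>d\<close>: the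
  symmetry proof needs mixed second derivatives, the Taylor expansion the case
  \<open>w = d\<close>.\<close>

lemma DERIV_gradient_along_line:
  assumes "twice_continuously_differentiable f"
  shows "((\<lambda>t. w \<bullet> gradient f (x + t *\<^sub>R d)) has_real_derivative
      w \<bullet> (hessian f (x + t *\<^sub>R d) *v d)) (at t)"
proof -
  have "((\<lambda>t. x + t *\<^sub>R d) has_derivative (\<lambda>h. h *\<^sub>R d)) (at t)"
    by (auto intro!: derivative_eq_intros)
  from has_derivative_inner_right[OF has_derivative_compose[OF this has_derivative_hessian[OF assms]]]
  show ?thesis
    by (simp add: has_field_derivative_def matrix_vector_mult_scaleR mult_commute_abs)
qed

text \<open>Two applications of the mean value theorem, first along \<open>u\<close> to a difference
  of values of \<open>f\<close>, then along \<open>v\<close> to a gradient component. The left-hand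
  side is symmetric in \<open>u\<close> and \<open>v\<close>, which drives the symmetry of the
  Hessian.\<close>

lemma second_difference_eq_hessian:
  assumes f: "twice_continuously_differentiable f" and s: "s > 0"
  obtains \<tau> \<sigma> where "0 < \<tau>" "\<tau> < s" "0 < \<sigma>" "\<sigma> < s"
    and "f (x + s *\<^sub>R u + s *\<^sub>R v) - f (x + s *\<^sub>R u) - f (x + s *\<^sub>R v) + f x
      = s\<^sup>2 * (u \<bullet> (hessian f (x + \<tau> *\<^sub>R u + \<sigma> *\<^sub>R v) *v v))"
proof -
  let ?\<phi> = "\<lambda>t. f ((x + s *\<^sub>R v) + t *\<^sub>R u) - f (x + t *\<^sub>R u)"
  have "\<exists>\<tau>>0. \<tau> < s \<and> ?\<phi> s - ?\<phi> 0 =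
      (s - 0) * (u \<bullet> gradient f ((x + s *\<^sub>R v) + \<tau> *\<^sub>R u) - u \<bullet> gradient f (x + \<tau> *\<^sub>R u))"
    by (rule MVT2[OF s]) (intro DERIV_diff DERIV_along_line[OF f])
  then obtain \<tau> where \<tau>: "0 < \<tau>" "\<tau> < s" and \<phi>: "?\<phi> s - ?\<phi> 0 =
      (s - 0) * (u \<bullet> gradient f ((x + s *\<^sub>R v) + \<tau> *\<^sub>R u) - u \<bullet> gradient f (x + \<tau> *\<^sub>R u))"
    by blast
  let ?\<psi> = "\<lambda>r. u \<bullet> gradient f ((x + \<tau> *\<^sub>R u) + r *\<^sub>R v)"
  have "\<exists>\<sigma>>0. \<sigma> < s \<and> ?\<psi> s - ?\<psi> 0 = (s - 0) * (u \<bullet> (hessian f ((x + \<tau> *\<^sub>R u) + \<sigma> *\<^sub>R v) *v v))"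
    by (rule MVT2[OF s]) (rule DERIV_gradient_along_line[OF f])
  then obtain \<sigma> where \<sigma>: "0 < \<sigma>" "\<sigma> < s"
    and \<psi>: "?\<psi> s - ?\<psi> 0 = (s - 0) * (u \<bullet> (hessian f ((x + \<tau> *\<^sub>R u) + \<sigma> *\<^sub>R v) *v v))"
    by blast
  show thesis
    using that[OF \<tau> \<sigma>] \<phi> \<psi> by (simp add: algebra_simps power2_eq_square)
qed

text \<open>One sequence of second difference quotients tends to both
  \<open>u \<bullet> (hessian f x *v v)\<close> and \<open>v \<bullet> (hessian f x *v u)\<close>,
  so uniqueness of limits identifies them.\<close>

lemma transpose_hessian:
  assumes f: "twice_continuously_differentiable f"
  shows "transpose (hessian f x) = hessian f x"
proof -
  \<comment> \<open>Naming the sequence by an equation lets the fact be applied to the same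
    \<open>\<Delta>\<close> with \<open>u\<close> and \<open>v\<close> in either order.\<close>
  have lim: "\<exists>p. p \<longlonglongrightarrow> x \<and> (\<forall>n. \<Delta> n = u \<bullet> (hessian f (p n) *v v))"
    if \<Delta>: "\<Delta> = (\<lambda>n. let s = 1 / real (Suc n) in
        (f (x + s *\<^sub>R u + s *\<^sub>R v) - f (x + s *\<^sub>R u) - f (x + s *\<^sub>R v) + f x) / s\<^sup>2)"
    for u v \<Delta>
  proof -
    have "\<exists>\<tau> \<sigma>. \<bar>\<tau>\<bar> \<le> 1 / real (Suc n) \<and> \<bar>\<sigma>\<bar> \<le> 1 / real (Suc n)
        \<and> \<Delta> n = u \<bullet> (hessian f (x + \<tau> *\<^sub>R u + \<sigma> *\<^sub>R v) *v v)" for n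
    proof -
      have s: "1 / real (Suc n) > 0" by simp
      obtain \<tau> \<sigma> where "0 < \<tau>" "\<tau> < 1 / real (Suc n)" "0 < \<sigma>" "\<sigma> < 1 / real (Suc n)"
        and eq: "f (x + (1 / real (Suc n)) *\<^sub>R u + (1 / real (Suc n)) *\<^sub>R v)
            - f (x + (1 / real (Suc n)) *\<^sub>R u) - f (x + (1 / real (Suc n)) *\<^sub>R v) + f x
          = (1 / real (Suc n))\<^sup>2 * (u \<bullet> (hessian f (x + \<tau> *\<^sub>R u + \<sigma> *\<^sub>R v) *v v))"
        using second_difference_eq_hessian[OF f s] by blast
      moreover have "\<Delta> n = u \<bullet> (hessian f (x + \<tau> *\<^sub>R u + \<sigma> *\<^sub>R v) *v v)"
        unfolding \<Delta> Let_def eq by simp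
      ultimately show ?thesis
        by (intro exI[of _ \<tau>] exI[of _ \<sigma>]) linarith
    qed
    then obtain \<tau> \<sigma> where \<tau>: "\<And>n. \<bar>\<tau> n\<bar> \<le> 1 / real (Suc n)" and \<sigma>: "\<And>n. \<bar>\<sigma> n\<bar> \<le> 1 / real (Suc n)"
      and eq: "\<And>n. \<Delta> n = u \<bullet> (hessian f (x + \<tau> n *\<^sub>R u + \<sigma> n *\<^sub>R v) *v v)"
      by metis
    have "(\<lambda>n. 1 / real (Suc n)) \<longlonglongrightarrow> 0"
      by (rule LIMSEQ_Suc[OF lim_1_over_n])
    then have "\<tau> \<longlonglongrightarrow> 0" "\<sigma> \<longlonglongrightarrow> 0"
      by (auto intro!: Lim_null_comparison[where g = "\<lambda>n. 1 / real (Suc n)"] always_eventually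
          simp: \<tau> \<sigma> simp del: of_nat_Suc)
    then have "(\<lambda>n. x + \<tau> n *\<^sub>R u + \<sigma> n *\<^sub>R v) \<longlonglongrightarrow> x + 0 *\<^sub>R u + 0 *\<^sub>R v"
      by (intro tendsto_intros)
    then show ?thesis
      using eq by (intro exI[of _ "\<lambda>n. x + \<tau> n *\<^sub>R u + \<sigma> n *\<^sub>R v"]) simp
  qed
  \<comment> \<open>Continuity of the second derivatives enters here: the intermediate points
    \<open>p n\<close> vary with n.\<close>
  have cont: "(\<lambda>n. u \<bullet> (hessian f (p n) *v v)) \<longlonglongrightarrow> u \<bullet> (hessian f x *v v)"
    if "p \<longlonglongrightarrow> x" for p u v
  proof -
    have "continuous_on UNIV (\<lambda>y. u \<bullet> (hessian f y *v v))"
      by (intro continuous_intros continuous_on_hessian[OF f])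
    then show ?thesis
      using that by (rule continuous_on_tendsto_compose) auto
  qed
  show ?thesis
    unfolding symmetric_matrix_iff_inner
  proof (intro allI)
    fix u v
    define \<Delta> where "\<Delta> = (\<lambda>n. let s = 1 / real (Suc n) in
      (f (x + s *\<^sub>R u + s *\<^sub>R v) - f (x + s *\<^sub>R u) - f (x + s *\<^sub>R v) + f x) / s\<^sup>2)"
    have "\<Delta> \<longlonglongrightarrow> u \<bullet> (hessian f x *v v)"
      using lim[OF \<Delta>_def] cont by (metis (no_types, lifting) ext)
    moreover have "\<Delta> = (\<lambda>n. let s = 1 / real (Suc n) in
        (f (x + s *\<^sub>R v + s *\<^sub>R u) - f (x + s *\<^sub>R v) - f (x + s *\<^sub>R u) + f x) / s\<^sup>2)"
      unfolding \<Delta>_def by (simp add: Let_def algebra_simps)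
    then have "\<Delta> \<longlonglongrightarrow> v \<bullet> (hessian f x *v u)"
      using lim[of \<Delta> v u] cont by (metis (no_types, lifting) ext)
    ultimately show "u \<bullet> (hessian f x *v v) = v \<bullet> (hessian f x *v u)"
      by (rule LIMSEQ_unique)
  qed
qed

section \<open>Sharpness along a segment\<close>

text \<open>On the reals \<open>SUP\<close> bounds the values from above only if they are bounded.
  Embedding them in a compact set of Rayleigh values avoids proving \<open>lambda_max\<close>
  continuous.\<close>

lemma bdd_above_sharpness:
  assumes f: "twice_continuously_differentiable f" and S: "compact S"
  shows "bdd_above (sharpness f ` S)"
proof -
  have "continuous_on (S \<times> sphere 0 1) (\<lambda>p. hessian f (fst p))"
    by (rule continuous_on_compose2[OF continuous_on_hessian[OF f]]) (auto intro: continuous_intros)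
  then have "continuous_on (S \<times> sphere 0 1) (\<lambda>p. snd p \<bullet> (hessian f (fst p) *v snd p))"
    by (intro continuous_intros)
  then have "compact ((\<lambda>p. snd p \<bullet> (hessian f (fst p) *v snd p)) ` (S \<times> sphere 0 1))"
    by (intro compact_continuous_image compact_Times S compact_sphere)
  then have "bdd_above ((\<lambda>p. snd p \<bullet> (hessian f (fst p) *v snd p)) ` (S \<times> sphere 0 1))"
    by (intro bounded_imp_bdd_above compact_imp_bounded)
  moreover have "sharpness f ` S \<subseteq> (\<lambda>p. snd p \<bullet> (hessian f (fst p) *v snd p)) ` (S \<times> sphere 0 1)"
  proof (rule image_subsetI)
    fix x assume "x \<in> S"
    obtain v where "norm v = 1" "v \<bullet> (hessian f x *v v) = sharpness f x"
      unfolding sharpness_def using lambda_max_Rayleigh[OF transpose_hessian[OF f]] by metis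
    with \<open>x \<in> S\<close> show "sharpness f x \<in> (\<lambda>p. snd p \<bullet> (hessian f (fst p) *v snd p)) ` (S \<times> sphere 0 1)"
      by (intro image_eqI[of _ _ "(x, v)"]) auto
  qed
  ultimately show ?thesis
    by (rule bdd_above_mono)
qed

lemma Taylor_second_order_segment:
  assumes f: "twice_continuously_differentiable f"
  obtains \<xi> where "\<xi> \<in> closed_segment x (x + d)"
    and "f (x + d) = f x + d \<bullet> gradient f x + (d \<bullet> (hessian f \<xi> *v d)) / 2"
proof -
  \<comment> \<open>The derivatives of orders 0, 1 and 2 of f along the line, in the indexed form
    that \<open>Maclaurin\<close> expects.\<close>
  let ?D = "\<lambda>(m::nat) t. if m = 0 then f (x + t *\<^sub>R d) else if m = 1 then d \<bullet> gradient f (x + t *\<^sub>R d)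
    else d \<bullet> (hessian f (x + t *\<^sub>R d) *v d)"
  have "\<exists>t::real. 0 < t \<and> t < 1 \<and>
      f (x + 1 *\<^sub>R d) = (\<Sum>m<2. (?D m 0 / fact m) * 1 ^ m) + (?D 2 t / fact 2) * 1 ^ 2"
    by (rule Maclaurin)
      (auto simp: less_2_cases_iff intro: DERIV_along_line[OF f] DERIV_gradient_along_line[OF f])
  then obtain t where t: "0 < t" "t < 1"
    and eq: "f (x + d) = f x + d \<bullet> gradient f x + (d \<bullet> (hessian f (x + t *\<^sub>R d) *v d)) / 2"
    by (auto simp: numeral_2_eq_2)
  have "x + t *\<^sub>R d \<in> closed_segment x (x + d)"
    using t unfolding in_segment by (intro exI[of _ t]) (simp add: algebra_simps)
  then show thesis
    using eq that by blast
qed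

theorem corollary1:
  fixes f :: "real^'n \<Rightarrow> real" and \<eta> :: real and \<theta> \<theta>' :: "real^'n"
  assumes "twice_continuously_differentiable f"
    and "\<eta> > 0"
    and "gradient f \<theta> \<noteq> 0"
    and "\<theta>' = \<theta> - \<eta> *\<^sub>R gradient f \<theta>"
  shows "2 / \<eta> * (relative_progress \<eta> f \<theta> + 1) \<le> (SUP x \<in> closed_segment \<theta> \<theta>'. sharpness f x)"
proof -
  note f = assms(1)
  define g where "g = gradient f \<theta>"
  have \<theta>': "\<theta>' = \<theta> + (- \<eta>) *\<^sub>R g"
    using assms(4) by (simp add: g_def)
  obtain \<xi> where \<xi>: "\<xi> \<in> closed_segment \<theta> \<theta>'"
    and "f \<theta>' = f \<theta> + ((- \<eta>) *\<^sub>R g) \<bullet> g + ((- \<eta>) *\<^sub>R g) \<bullet> (hessian f \<xi> *v ((- \<eta>) *\<^sub>R g)) / 2"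
    using Taylor_second_order_segment[OF f, of \<theta> "(- \<eta>) *\<^sub>R g"] unfolding \<theta>' g_def by blast
  then have eq: "f \<theta>' - f \<theta> = - \<eta> * (norm g)\<^sup>2 + \<eta>\<^sup>2 * (g \<bullet> (hessian f \<xi> *v g)) / 2"
    by (simp only: matrix_vector_mult_scaleR inner_scaleR_left inner_scaleR_right dot_square_norm)
       (simp add: power2_eq_square)
  have g: "(norm g)\<^sup>2 > 0"
    using assms(3) by (simp add: g_def)
  have "relative_progress \<eta> f \<theta> = (f \<theta>' - f \<theta>) / (\<eta> * (norm g)\<^sup>2)"
    by (simp add: relative_progress_def assms(4) g_def)
  also have "\<dots> = \<eta> / 2 * (g \<bullet> (hessian f \<xi> *v g) / (norm g)\<^sup>2) - 1"
    unfolding eq using g \<open>\<eta> > 0\<close> by (simp add: field_simps power2_eq_square[of \<eta>])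
  \<comment> \<open>The left-hand side is exactly the Rayleigh quotient of the Hessian at
    \<open>\<xi>\<close> in the gradient direction; only the passage to its maximum and then to the
    supremum loses anything.\<close>
  finally have "2 / \<eta> * (relative_progress \<eta> f \<theta> + 1) = g \<bullet> (hessian f \<xi> *v g) / (norm g)\<^sup>2"
    using \<open>\<eta> > 0\<close> by simp
  also have "\<dots> \<le> sharpness f \<xi>"
  proof -
    have "g \<bullet> (hessian f \<xi> *v g) \<le> sharpness f \<xi> * (norm g)\<^sup>2"
      unfolding sharpness_def using lambda_max_Rayleigh[OF transpose_hessian[OF f]] by metis
    then show ?thesis
      using g by (simp add: pos_divide_le_eq)
  qed
  also have "\<dots> \<le> (SUP x \<in> closed_segment \<theta> \<theta>'. sharpness f x)"
    by (rule cSUP_upper[OF \<xi> bdd_above_sharpness[OF f compact_segment]])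
  finally show ?thesis .
qed

end
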